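(* Let $z,w\in\mathbb C\setminus\mathbb Z$ with $\Re(z+w)>-1/2$. There exists a positive constant $c(z,w)$ such that almost surely with respect to the $(z,w)$-measure $\rho_{z,w}$ on $\mathcal T$, $$\varlimsup_{N\to\infty}\frac{\tilde s_N}{\log(N)}\le c(z,w),$$ where, for $\tau\in\mathcal T$, $\tilde s_N(\tau)$ is the length of the main diagonal of the positive Young diagram $\tau^+(N)$ of the signature $\tau(N)$.
   Context: A signature of level $N$ is an $N$-tuple of integers $\lambda=(\lambda_1\ge\dots\ge\lambda_N)$; $\mathbb{GT}_N$ is the set of these. For $\lambda\in\mathbb{GT}_N$, $\mu\in\mathbb{GT}_{N+1}$ write $\lambda\prec\mu$ if $\mu_1\ge\lambda_1\ge\mu_2\ge\dots\ge\lambda_N\ge\mu_{N+1}$. $\mathcal T$ is the set of infinite paths $\tau=(\tau(1),\tau(2),\dots)$ with $\tau(N)\in\mathbb{GT}_N$ and $\tau(N)\prec\tau(N+1)$ for all $N$, with the Borel $\sigma$-algebra of the topology whose base is given by the cylindrical sets $C_t=\{\tau\in\mathcal T:\tau(1)=t(1),\dots,\tau(N)=t(N)\}$, $t=(t(1),\dots,t(N))$ a finite path. The positive Young diagram $\tau^+(N)$ has as its row lengths the positive coordinates of $\tau(N)$. The main diagonal of a Young diagram consists of its boxes $(i,i)$; its length is the number of these boxes. $\operatorname{Dim}_N(\lambda)=\prod_{1\le i<j\le N}\frac{\lambda_i-\lambda_j+j-i}{j-i}$. For $z,w\in\mathbb C\setminus\mathbb Z$ with $\Re(z+w)>-1/2$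 let $$M_N^{z,w}(\lambda)=\frac1{S_N(z,w)}\prod_{i=1}^N\left|\frac{1}{\Gamma(z-\lambda_i+i)\,\Gamma(w+N+1+\lambda_i-i)}\right|^2\operatorname{Dim}_N^2(\lambda),$$ where $S_N(z,w)$ makes $M_N^{z,w}$ a probability distribution on $\mathbb{GT}_N$, and $P_N^{z,w}(\lambda)=M_N^{z,w}(\lambda)/\operatorname{Dim}_N(\lambda)$. The $(z,w)$-measure $\rho_{z,w}$ is the unique Borel probability measure on $\mathcal T$ with $\rho_{z,w}(C_t)=P_N^{z,w}(t(N))$ for every finite path $t=(t(1),\dots,t(N))$. *)

theory Defs
  imports "HOL-Probability.Probability"
begin

text \<open>A signature of level \<open>N\<close> is an integer list of length \<open>N\<close>; its coordinates are numbered
  from \<open>1\<close>, i.e. \<open>coord l i\<close> is $\lambda_i$.\<close>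

definition coord :: "int list \<Rightarrow> nat \<Rightarrow> int" where
  "coord l i = l ! (i - 1)"

definition GT :: "nat \<Rightarrow> int list set" where
  "GT N = {l. length l = N \<and> (\<forall>i j. 1 \<le> i \<longrightarrow> i \<le> j \<longrightarrow> j \<le> N \<longrightarrow> coord l i \<ge> coord l j)}"

definition interlaces :: "int list \<Rightarrow> int list \<Rightarrow> bool" where
  "interlaces l m \<longleftrightarrow> length m = Suc (length l) \<and>
     (\<forall>i\<in>{1..length l}. coord m i \<ge> coord l i \<and> coord l i \<ge> coord m (i + 1))"

text \<open>Paths start at level \<open>1\<close>. The conditions at level \<open>0\<close> only fix the unused value
  \<open>\<tau> 0 = []\<close>, the single element of \<open>GT 0\<close>, and are otherwise void.\<close>

definition paths :: "(nat \<Rightarrow> int list) set" where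
  "paths = {\<tau>. (\<forall>N. \<tau> N \<in> GT N) \<and> (\<forall>N. interlaces (\<tau> N) (\<tau> (Suc N)))}"

text \<open>\<open>finite_path N t\<close>: the values \<open>t 1, \<dots>, t N\<close> form a finite path; other values of \<open>t\<close>
  are irrelevant.\<close>

definition finite_path :: "nat \<Rightarrow> (nat \<Rightarrow> int list) \<Rightarrow> bool" where
  "finite_path N t \<longleftrightarrow> 1 \<le> N \<and> (\<forall>k\<in>{1..N}. t k \<in> GT k) \<and>
     (\<forall>k\<in>{1..<N}. interlaces (t k) (t (Suc k)))"

definition cylinder :: "nat \<Rightarrow> (nat \<Rightarrow> int list) \<Rightarrow> (nat \<Rightarrow> int list) set" where
  "cylinder N t = {\<tau> \<in> paths. \<forall>k\<in>{1..N}. \<tau> k = t k}"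

definition path_topology :: "(nat \<Rightarrow> int list) topology" where
  "path_topology = topology_generated_by {cylinder N t | N t. finite_path N t}"

definition path_borel :: "(nat \<Rightarrow> int list) measure" where
  "path_borel = sigma (topspace path_topology) {U. openin path_topology U}"

lemma topspace_path_topology: "topspace path_topology = paths"
proof -
  have "\<tau> \<in> \<Union>{cylinder N t | N t. finite_path N t}" if "\<tau> \<in> paths" for \<tau>
  proof -
    have "finite_path 1 \<tau>" "\<tau> \<in> cylinder 1 \<tau>"
      using that by (auto simp: finite_path_def cylinder_def paths_def)
    then show ?thesis by blast
  qed
  moreover have "\<Union>{cylinder N t | N t. finite_path N t} \<subseteq> paths"
    by (auto simp: cylinder_def)
  ultimately show ?thesis
    unfolding path_topology_def topology_generated_by_topspace by blast
qed

lemma space_path_borel: "space path_borel = paths"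
proof -
  have "{U. openin path_topology U} \<subseteq> Pow (topspace path_topology)"
    by (auto dest: openin_subset)
  then show ?thesis
    unfolding path_borel_def by (simp add: space_measure_of topspace_path_topology)
qed

definition Dim :: "nat \<Rightarrow> int list \<Rightarrow> real" where
  "Dim N l = (\<Prod>(i, j)\<in>{(i, j). 1 \<le> i \<and> i < j \<and> j \<le> N}.
     (real_of_int (coord l i) - real_of_int (coord l j) + real j - real i) / (real j - real i))"

definition zw_weight :: "complex \<Rightarrow> complex \<Rightarrow> nat \<Rightarrow> int list \<Rightarrow> real" where
  "zw_weight z w N l =
     (\<Prod>i\<in>{1..N}. (cmod (1 / (Gamma (z - of_int (coord l i) + of_nat i) *
        Gamma (w + of_nat N + 1 + of_int (coord l i) - of_nat i))))\<^sup>2) * (Dim N l)\<^sup>2"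

definition zw_S :: "complex \<Rightarrow> complex \<Rightarrow> nat \<Rightarrow> real" where
  "zw_S z w N = (\<Sum>\<^sub>\<infinity>l\<in>GT N. zw_weight z w N l)"

definition zw_M :: "complex \<Rightarrow> complex \<Rightarrow> nat \<Rightarrow> int list \<Rightarrow> real" where
  "zw_M z w N l = 1 / zw_S z w N * zw_weight z w N l"

definition zw_P :: "complex \<Rightarrow> complex \<Rightarrow> nat \<Rightarrow> int list \<Rightarrow> real" where
  "zw_P z w N l = zw_M z w N l / Dim N l"

text \<open>The defining property of the \<open>(z,w)\<close>-measure; \<open>is_zw_measure_unique\<close> below shows that
  at most one measure has it.\<close>

definition is_zw_measure :: "complex \<Rightarrow> complex \<Rightarrow> (nat \<Rightarrow> int list) measure \<Rightarrow> bool" where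
  "is_zw_measure z w \<rho> \<longleftrightarrow> prob_space \<rho> \<and> sets \<rho> = sets path_borel \<and>
     (\<forall>N t. finite_path N t \<longrightarrow> measure \<rho> (cylinder N t) = zw_P z w N (t N))"

definition path_base :: "(nat \<Rightarrow> int list) set set" where
  "path_base = insert {} {cylinder N t | N t. finite_path N t}"

lemma cylinder_Int:
  assumes "N \<le> N'"
  shows "cylinder N t \<inter> cylinder N' t' = {} \<or> cylinder N t \<inter> cylinder N' t' = cylinder N' t'"
proof (cases "\<forall>k\<in>{1..N}. t k = t' k")
  case True
  then have "cylinder N' t' \<subseteq> cylinder N t"
    using assms by (auto simp: cylinder_def)
  then show ?thesis by blast
next
  case False
  then have "cylinder N t \<inter> cylinder N' t' = {}"
    using assms unfolding cylinder_def by force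
  then show ?thesis by blast
qed

lemma path_base_Int:
  assumes "A \<in> path_base" "B \<in> path_base"
  shows "A \<inter> B \<in> path_base"
proof (cases "A = {} \<or> B = {}")
  case True
  then show ?thesis by (auto simp: path_base_def)
next
  case False
  then obtain N t N' t' where *: "A = cylinder N t" "B = cylinder N' t'"
    using assms by (auto simp: path_base_def)
  have "A \<inter> B = {} \<or> A \<inter> B = A \<or> A \<inter> B = B"
  proof (cases "N \<le> N'")
    case True
    then show ?thesis using cylinder_Int[OF True, of t t'] unfolding * by blast
  next
    case False
    then have "N' \<le> N" by simp
    then show ?thesis using cylinder_Int[of N' N t' t] unfolding * by blast
  qed
  then show ?thesis using assms by (auto simp: path_base_def)
qed

lemma countable_path_base: "countable path_base"
proof -
  have "cylinder N t \<in> (\<lambda>xs. cylinder (length xs) (\<lambda>k. xs ! (k - 1))) ` UNIV" for N t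
  proof
    show "cylinder N t = cylinder (length (map t [1..<Suc N]))
        (\<lambda>k. map t [1..<Suc N] ! (k - 1))"
      by (auto simp: cylinder_def nth_append simp del: upt_Suc)
  qed simp
  then have "path_base \<subseteq> insert {} ((\<lambda>xs. cylinder (length xs) (\<lambda>k. xs ! (k - 1))) ` UNIV)"
    by (auto simp: path_base_def)
  then show ?thesis
    by (rule countable_subset) simp
qed

lemma openin_path_topology_imp:
  assumes "openin path_topology U"
  shows "\<exists>C\<subseteq>path_base. U = \<Union>C"
proof -
  have "generate_topology_on {cylinder N t | N t. finite_path N t} U"
    using assms by (simp add: path_topology_def openin_topology_generated_by_iff)
  then show ?thesis
  proof (induction rule: generate_topology_on.induct)
    case Empty
    show ?case by (rule exI[of _ "{}"]) simp
  next
    case (Int a b)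
    then obtain C D where "C \<subseteq> path_base" "a = \<Union>C" "D \<subseteq> path_base" "b = \<Union>D" by blast
    then have "(\<lambda>(x, y). x \<inter> y) ` (C \<times> D) \<subseteq> path_base"
      "a \<inter> b = \<Union>((\<lambda>(x, y). x \<inter> y) ` (C \<times> D))"
      using path_base_Int by auto
    then show ?case by blast
  next
    case (UN K)
    then obtain C where "\<And>k. k \<in> K \<Longrightarrow> C k \<subseteq> path_base \<and> k = \<Union>(C k)" by metis
    then show ?case
      by (intro exI[of _ "\<Union>(C ` K)"]) (auto, blast+)
  next
    case (Basis s)
    then show ?case
      by (intro exI[of _ "{s}"]) (auto simp: path_base_def)
  qed
qed

lemma sets_path_borel: "sets path_borel = sigma_sets paths path_base"
proof -
  have *: "sets path_borel = sigma_sets paths {U. openin path_topology U}"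
    unfolding path_borel_def topspace_path_topology
    by (rule sets_measure_of) (use openin_subset topspace_path_topology in blast)
  have "U \<in> sigma_sets paths path_base" if U: "openin path_topology U" for U
  proof -
    obtain C where C: "C \<subseteq> path_base" "U = \<Union>C"
      using openin_path_topology_imp[OF U] by blast
    have "countable C" using C countable_path_base countable_subset by blast
    then show ?thesis
      unfolding C(2) by (rule sigma_sets_UNION) (use C in auto)
  qed
  moreover have "A \<in> sigma_sets paths {U. openin path_topology U}" if "A \<in> path_base" for A
  proof -
    have "openin path_topology A"
      using that unfolding path_base_def path_topology_def
      by (auto intro: topology_generated_by_Basis)
    then show ?thesis by auto
  qed
  ultimately show ?thesis
    unfolding * by (intro equalityI sigma_sets_mono) auto
qed

lemma is_zw_measure_unique:
  assumes "is_zw_measure z w M" "is_zw_measure z w M'"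
  shows "M = M'"
proof -
  interpret M: prob_space M using assms by (simp add: is_zw_measure_def)
  interpret M': prob_space M' using assms by (simp add: is_zw_measure_def)
  have sets: "sets M = sigma_sets paths path_base" "sets M' = sigma_sets paths path_base"
    using assms by (auto simp: is_zw_measure_def sets_path_borel)
  show ?thesis
  proof (rule measure_eqI_generator_eq_countable[where E = path_base and A = path_base])
    show "Int_stable path_base" by (auto simp: Int_stable_def path_base_Int)
    show "path_base \<subseteq> Pow paths" by (auto simp: path_base_def cylinder_def)
    show "emeasure M X = emeasure M' X" if "X \<in> path_base" for X
      using that assms
      by (auto simp: path_base_def is_zw_measure_def M.emeasure_eq_measure M'.emeasure_eq_measure)
    show "\<Union>path_base = paths"
      using topspace_path_topology
      unfolding path_topology_def topology_generated_by_topspace path_base_def by auto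
    show "countable path_base" by (rule countable_path_base)
    show "emeasure M X \<noteq> \<infinity>" for X by simp
  qed (use sets in auto)
qed

text \<open>A Young diagram is a set of boxes, given here by its list of row lengths.\<close>

definition young_diagram :: "int list \<Rightarrow> (nat \<times> nat) set" where
  "young_diagram r = {(i, j). 1 \<le> i \<and> i \<le> length r \<and> 1 \<le> j \<and> int j \<le> coord r i}"

definition positive_diagram :: "int list \<Rightarrow> (nat \<times> nat) set" where
  "positive_diagram l = young_diagram (filter (\<lambda>a. 0 < a) l)"

definition diagonal_length :: "(nat \<times> nat) set \<Rightarrow> nat" where
  "diagonal_length D = card {b \<in> D. fst b = snd b}"

definition s_tilde :: "nat \<Rightarrow> (nat \<Rightarrow> int list) \<Rightarrow> nat" where
  "s_tilde N \<tau> = diagonal_length (positive_diagram (\<tau> N))"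

end

theory Submission
  imports Defs
begin

text \<open>
  Why the theorem holds: along a path the diagonal length \<open>s_tilde N\<close> grows by \<open>0\<close> or \<open>1\<close> at each
  step, and for large \<open>N\<close>, conditionally on its present value, the step \<open>N \<rightarrow> N + 1\<close> produces a new
  diagonal box with probability at most \<open>K / (N + 1)\<close>. So the expectation of \<open>2\<close> to the power
  \<open>s_tilde N\<close> grows at most polynomially in \<open>N\<close> (\<open>polynomial_growth\<close>), and Markov's
  inequality together with Borel--Cantelli gives the logarithmic bound (\<open>AE_s_tilde_less_log\<close>).

  For the step bound, let $\lambda \prec \mu$ be consecutive signatures, let \<open>k\<close> be the diagonal
  length of $\lambda$, and suppose that $\mu$ has a new diagonal box, that is
  $\mu_{k+1} = k + a$ with $a \ge 1$. Let $\mu'$ be $\mu$ with $\mu_{k+1}$ lowered to \<open>k\<close>. Then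
  $\lambda \prec \mu'$ still holds (\<open>reset_new_diagonal_box\<close>), because interlacing restricts
  each coordinate of $\mu$ to an interval determined by $\lambda$ alone, and the map
  $(\lambda, \mu) \mapsto (\lambda, \mu')$ is injective for fixed \<open>k\<close> and \<open>a\<close>. Since the
  cylinder of a finite path has measure $P_n(\mu) = M_n(\mu) / \mathrm{Dim}_n(\mu)$ with
  $n = N + 1$, it is enough to compare $P_n(\mu)$ with $P_n(\mu')$. Only one factor of the product
  of Gamma functions changes, and in points $\mu_i - i$ the dimension is a Vandermonde
  determinant in which a single point moves: its distances to the points on its right shrink, and
  those to the \<open>j\<close>-th point on its left grow at most by the factor $(a + j) / j$, as if the
  points on the left were densely packed. This gives (\<open>zw_P_reset_le\<close>)
  \[ P_n(\mu) \le r_n(a)\, P_n(\mu'), \qquad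
     r_n(a) = \prod_{j<a} \frac{|z - j|^2}{|w + n + j|^2} \cdot \frac{n + j}{j + 1}. \]
  The factor \<open>j = 0\<close> is of order \<open>1 / n\<close>, and the others are small enough for
  $\sum_{a \ge 1} r_n(a) \le K / n$ (\<open>sum_reset_ratio_le\<close>).
\<close>

section \<open>Diagonals of interlacing signatures\<close>

abbreviation diag :: "int list \<Rightarrow> nat" where
  "diag l \<equiv> diagonal_length (positive_diagram l)"

text \<open>The positive coordinates of a signature form an initial segment of it, so filtering does
  not renumber them; a coordinate that is at least its own index is positive.\<close>

lemma coord_filter_pos:
  assumes l: "l \<in> GT n"
  shows "1 \<le> i \<and> i \<le> length (filter (\<lambda>a. 0 < a) l) \<and> int i \<le> coord (filter (\<lambda>a. 0 < a) l) i
    \<longleftrightarrow> 1 \<le> i \<and> i \<le> n \<and> int i \<le> coord l i"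
proof -
  let ?P = "\<lambda>a::int. 0 < a"
  have len: "length l = n" and mono: "\<And>i j. 1 \<le> i \<Longrightarrow> i \<le> j \<Longrightarrow> j \<le> n \<Longrightarrow> coord l j \<le> coord l i"
    using l by (auto simp: GT_def)
  have mono': "l ! j \<le> l ! i" if "i \<le> j" "j < n" for i j
    using mono[of "Suc i" "Suc j"] that by (simp add: coord_def)
  have "sorted (rev l)"
    unfolding sorted_iff_nth_mono by (auto simp: rev_nth len intro!: mono')
  then have fl: "filter ?P l = takeWhile ?P l"
    using filter_equals_takeWhile_sorted_rev[of "\<lambda>x. x" l 0] by simp
  have len_tw: "length (takeWhile ?P l) \<le> n"
    using length_takeWhile_le[of ?P l] len by simp
  have le_tw: "i \<le> length (takeWhile ?P l)" if i: "1 \<le> i" "i \<le> n" "int i \<le> coord l i"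
  proof (rule ccontr)
    assume "\<not> i \<le> length (takeWhile ?P l)"
    then have less: "length (takeWhile ?P l) < i" by simp
    then have "\<not> ?P (l ! length (takeWhile ?P l))"
      using nth_length_takeWhile[of ?P l] i len by simp
    moreover have "l ! (i - 1) \<le> l ! length (takeWhile ?P l)"
      using less i by (intro mono') auto
    ultimately show False using i by (simp add: coord_def)
  qed
  have nth_tw: "coord (takeWhile ?P l) i = coord l i" if "1 \<le> i" "i \<le> length (takeWhile ?P l)"
    unfolding coord_def by (rule takeWhile_nth) (use that in simp)
  show ?thesis
    unfolding fl using len_tw le_tw nth_tw by auto
qed

lemma diag_eq_card:
  assumes "l \<in> GT n"
  shows "diag l = card {i \<in> {1..n}. int i \<le> coord l i}"
proof -
  have "{b \<in> positive_diagram l. fst b = snd b} = (\<lambda>i. (i, i)) `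
      {i. 1 \<le> i \<and> i \<le> length (filter (\<lambda>a. 0 < a) l) \<and> int i \<le> coord (filter (\<lambda>a. 0 < a) l) i}"
    by (auto simp: positive_diagram_def young_diagram_def)
  also have "\<dots> = (\<lambda>i. (i, i)) ` {i \<in> {1..n}. int i \<le> coord l i}"
    unfolding coord_filter_pos[OF assms] by auto
  finally have "{b \<in> positive_diagram l. fst b = snd b} = (\<lambda>i. (i, i)) ` {i \<in> {1..n}. int i \<le> coord l i}" .
  moreover have "inj_on (\<lambda>i. (i, i)) S" for S :: "nat set"
    by (auto simp: inj_on_def)
  ultimately show ?thesis
    by (simp add: diagonal_length_def card_image)
qed

text \<open>The sequence $\lambda_i - i$ is strictly decreasing, so the indices with
  $\lambda_i \ge i$ form an initial segment, and its length is the diagonal length.\<close>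

lemma le_diag_iff:
  assumes l: "l \<in> GT n" and i: "1 \<le> i" "i \<le> n"
  shows "i \<le> diag l \<longleftrightarrow> int i \<le> coord l i"
proof -
  let ?S = "{i \<in> {1..n}. int i \<le> coord l i}"
  have down: "int j \<le> coord l j" if "1 \<le> j" "j \<le> k" "k \<le> n" "int k \<le> coord l k" for j k
    using l that by (fastforce simp: GT_def)
  show ?thesis
  proof
    assume *: "int i \<le> coord l i"
    have "{1..i} \<subseteq> ?S" using down[of _ i] * i by auto
    then have "card {1..i} \<le> card ?S" by (intro card_mono) auto
    then show "i \<le> diag l" by (simp add: diag_eq_card[OF l])
  next
    assume *: "i \<le> diag l"
    show "int i \<le> coord l i"
    proof (rule ccontr)
      assume "\<not> int i \<le> coord l i"
      then have "j < i" if "j \<in> ?S" for j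
        using down[of i j] i that by (cases "j < i") auto
      then have "?S \<subseteq> {1..<i}" by auto
      then have "card ?S \<le> card {1..<i}" by (intro card_mono) auto
      then show False using * i by (simp add: diag_eq_card[OF l])
    qed
  qed
qed

lemma diag_le:
  assumes "l \<in> GT n"
  shows "diag l \<le> n"
proof -
  have "card {i \<in> {1..n}. int i \<le> coord l i} \<le> card {1..n}"
    by (intro card_mono) auto
  then show ?thesis by (simp add: diag_eq_card[OF assms])
qed

lemma diag_interlaces:
  assumes l: "l \<in> GT n" and m: "m \<in> GT (Suc n)" and lm: "interlaces l m"
  shows "diag m = diag l \<or> diag m = Suc (diag l)"
proof -
  have len: "length l = n" using l by (simp add: GT_def)
  have 1: "diag l \<le> diag m"
  proof (cases "diag l = 0")
    case False
    then have k: "1 \<le> diag l" "diag l \<le> n" using diag_le[OF l] by auto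
    then have "int (diag l) \<le> coord l (diag l)" using le_diag_iff[OF l] by blast
    also have "\<dots> \<le> coord m (diag l)" using lm k by (simp add: interlaces_def len)
    finally show ?thesis using le_diag_iff[OF m, of "diag l"] k by simp
  qed simp
  have 2: "diag m \<le> Suc (diag l)"
  proof (rule ccontr)
    assume "\<not> ?thesis"
    then have ge: "Suc (Suc (diag l)) \<le> diag m" by simp
    then have k: "Suc (diag l) \<le> n" using diag_le[OF m] by simp
    have "int (Suc (Suc (diag l))) \<le> coord m (Suc (Suc (diag l)))"
      using le_diag_iff[OF m, of "Suc (Suc (diag l))"] ge k by simp
    also have "\<dots> \<le> coord l (Suc (diag l))"
      using lm k by (auto simp: interlaces_def len)
    finally have "int (Suc (diag l)) \<le> coord l (Suc (diag l))" by simp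
    then show False using le_diag_iff[OF l, of "Suc (diag l)"] k by simp
  qed
  show ?thesis using 1 2 by linarith
qed

lemma coord_update:
  assumes "k < length m" "1 \<le> i" 
  shows "coord (m[k := x]) i = (if i = Suc k then x else coord m i)"
  using assms by (auto simp: coord_def nth_list_update)

text \<open>The possible values of $\mu_{k+1}$ are those in $[\lambda_{k+1}, \lambda_k]$, an end point
  that does not exist being no constraint. As \<open>k\<close> is the diagonal length of
  $\lambda$, the left end point is at most \<open>k\<close> and the right one at least \<open>k\<close>. Hence \<open>k\<close>, the largest value that creates no new diagonal box, is
  always available. The list index \<open>k\<close> is the coordinate \<open>k + 1\<close>. The bound on the later
  coordinates is what the comparison of dimensions below needs.\<close>

lemma reset_new_diagonal_box:
  assumes l: "l \<in> GT n" and m: "m \<in> GT (Suc n)" and lm: "interlaces l m"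
    and inc: "diag m = Suc (diag l)"
  defines "k \<equiv> diag l"
  shows "m[k := int k] \<in> GT (Suc n)" and "interlaces l (m[k := int k])"
    and "\<And>j. Suc k < j \<Longrightarrow> j \<le> Suc n \<Longrightarrow> coord m j \<le> int k"
    and "k \<le> n" and "int (Suc k) \<le> coord m (Suc k)"
proof -
  have len: "length l = n" "length m = Suc n" using l m by (auto simp: GT_def)
  show kn: "k \<le> n" using diag_le[OF l] by (simp add: k_def)
  show mk: "int (Suc k) \<le> coord m (Suc k)"
    using le_diag_iff[OF m, of "Suc k"] inc kn by (simp add: k_def)
  have lk: "int k \<le> coord l k" if "1 \<le> k"
    using le_diag_iff[OF l, of k] that kn by (simp add: k_def)
  have lk1: "coord l (Suc k) \<le> int k" if "Suc k \<le> n"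
    using le_diag_iff[OF l, of "Suc k"] that by (simp add: k_def)
  show right: "coord m j \<le> int k" if j: "Suc k < j" "j \<le> Suc n" for j
  proof -
    have "coord m j \<le> coord l (j - 1)"
      using lm j len by (auto simp: interlaces_def dest!: bspec[of _ _ "j - 1"])
    also have "\<dots> \<le> coord l (Suc k)" using l j by (auto simp: GT_def)
    also have "\<dots> \<le> int k" using lk1 j by simp
    finally show ?thesis .
  qed
  have left: "int k \<le> coord m j" if "1 \<le> j" "j < Suc k" for j
  proof -
    have "coord m (Suc k) \<le> coord m j" using m that kn by (auto simp: GT_def)
    then show ?thesis using mk by simp
  qed
  have mono: "\<And>i j. 1 \<le> i \<Longrightarrow> i \<le> j \<Longrightarrow> j \<le> Suc n \<Longrightarrow> coord m j \<le> coord m i"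
    using m by (auto simp: GT_def)
  show "m[k := int k] \<in> GT (Suc n)"
    unfolding GT_def using left right mono kn by (auto simp: len coord_update)
  show "interlaces l (m[k := int k])"
    unfolding interlaces_def
  proof (intro conjI ballI)
    fix i assume i: "i \<in> {1..length l}"
    then have *: "coord l i \<le> coord m i" "coord m (i + 1) \<le> coord l i"
      using lm by (auto simp: interlaces_def)
    show "coord l i \<le> coord (m[k := int k]) i"
      using * i kn lk1 by (auto simp: coord_update len)
    show "coord (m[k := int k]) (i + 1) \<le> coord l i"
      using * i kn lk by (auto simp: coord_update len)
  qed (simp add: len)
qed

section \<open>Comparing the weights of a signature and its reset\<close>

lemma Dim_pos:
  assumes "l \<in> GT n"
  shows "Dim n l > 0"
  unfolding Dim_def
proof (rule prod_pos, clarify)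
  fix i j :: nat assume ij: "1 \<le> i" "i < j" "j \<le> n"
  then have "coord l j \<le> coord l i" using assms by (auto simp: GT_def)
  then show "0 < (real_of_int (coord l i) - real_of_int (coord l j) + real j - real i) / (real j - real i)"
    using ij by (intro divide_pos_pos) auto
qed

text \<open>Both sides are the binomial coefficient $\binom{m+a}{a}$.\<close>

lemma prod_ratio_binomial:
  "(\<Prod>d\<in>{1..m}. (real a + real d) / real d) = (\<Prod>j<a. (real m + 1 + real j) / (real j + 1))"
proof (induction a)
  case (Suc a)
  have tel: "(\<Prod>d\<in>{1..m}. (real (Suc a) + real d) / (real a + real d)) = (real m + 1 + real a) / (real a + 1)"
    by (induction m) (auto simp: field_simps)
  have "(\<Prod>d\<in>{1..m}. (real (Suc a) + real d) / real d)
      = (\<Prod>d\<in>{1..m}. (real a + real d) / real d) * (\<Prod>d\<in>{1..m}. (real (Suc a) + real d) / (real a + real d))"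
    unfolding prod.distrib[symmetric]
  proof (rule prod.cong)
    fix d assume "d \<in> {1..m}"
    then have "real a + real d \<noteq> 0" by simp
    then show "(real (Suc a) + real d) / real d
        = (real a + real d) / real d * ((real (Suc a) + real d) / (real a + real d))"
      by simp
  qed simp
  also have "\<dots> = (\<Prod>j<Suc a. (real m + 1 + real j) / (real j + 1))"
    unfolding tel Suc.IH by simp
  finally show ?case .
qed simp

text \<open>In a pair \<open>(i, Suc k)\<close> the lowered coordinate is subtracted, so the factor of the
  dimension can only increase. In a pair \<open>(Suc k, j)\<close> the numerator drops from \<open>a + b + d\<close> to
  \<open>b + d\<close>, where \<open>d = j - Suc k\<close> and \<open>b \<ge> 0\<close>, and this loss is largest for \<open>b = 0\<close>. The
  product of the worst losses \<open>(a + d) / d\<close> is a binomial coefficient.\<close>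

lemma Dim_reset_le:
  assumes m: "m \<in> GT n" and k: "k < n"
    and mk: "coord m (Suc k) = int k + int a"
    and m': "m[k := int k] \<in> GT n"
    and right: "\<And>j. Suc k < j \<Longrightarrow> j \<le> n \<Longrightarrow> coord m j \<le> int k"
  shows "Dim n m \<le> (\<Prod>j<a. (real n + real j) / (real j + 1)) * Dim n (m[k := int k])"
proof -
  let ?m' = "m[k := int k]"
  let ?I = "{(i, j). 1 \<le> i \<and> i < j \<and> j \<le> n}"
  let ?F = "\<lambda>l i j. (real_of_int (coord l i) - real_of_int (coord l j) + real j - real i) / (real j - real i)"
  let ?g = "\<lambda>i j. if i = Suc k then (real a + (real j - real i)) / (real j - real i) else 1"
  have finI: "finite ?I" by (rule finite_subset[of _ "{1..n} \<times> {1..n}"]) auto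
  have len: "length m = n" using m by (simp add: GT_def)
  have upd: "coord ?m' i = (if i = Suc k then int k else coord m i)" if "1 \<le> i" for i
    using coord_update[of k m i] that k len by simp
  have mono: "\<And>i j. 1 \<le> i \<Longrightarrow> i \<le> j \<Longrightarrow> j \<le> n \<Longrightarrow> coord m j \<le> coord m i"
    using m by (auto simp: GT_def)
  have fac: "0 \<le> ?F m i j \<and> ?F m i j \<le> ?g i j * ?F ?m' i j" if ij: "1 \<le> i" "i < j" "j \<le> n" for i j
  proof
    have "coord m j \<le> coord m i" using mono ij by simp
    then show "0 \<le> ?F m i j" using ij by (intro divide_nonneg_nonneg) auto
    show "?F m i j \<le> ?g i j * ?F ?m' i j"
    proof (cases "i = Suc k")
      case True
      define d where "d = real j - real i"
      define b where "b = real k - real_of_int (coord m j)"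
      have d: "d > 0" using ij by (simp add: d_def)
      have b: "b \<ge> 0" using right[of j] True ij by (simp add: b_def)
      have e1: "?F m i j = (real a + b + d) / d" using True mk by (simp add: d_def b_def)
      have e2: "?F ?m' i j = (b + d) / d" using True ij upd by (simp add: d_def b_def)
      have e3: "?g i j = (real a + d) / d" using True by (simp add: d_def)
      have "(real a + b + d) * d \<le> (real a + d) * (b + d)"
        using b by (simp add: algebra_simps)
      then have "(real a + b + d) * d / (d * d) \<le> (real a + d) * (b + d) / (d * d)"
        using d by (intro divide_right_mono) auto
      then have "(real a + b + d) / d \<le> (real a + d) * (b + d) / (d * d)"
        using d by simp
      then show ?thesis unfolding e1 e2 e3 by simp
    next
      case False
      have "coord ?m' j \<le> coord m j" using upd[of j] mk ij by auto
      moreover have "coord ?m' i = coord m i" using upd[of i] False ij by auto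
      ultimately show ?thesis using False ij by (auto intro!: divide_right_mono)
    qed
  qed
  have Dim': "Dim n ?m' \<ge> 0" using Dim_pos[OF m'] by simp
  have "Dim n m = (\<Prod>(i, j)\<in>?I. ?F m i j)" by (simp add: Dim_def)
  also have "\<dots> \<le> (\<Prod>(i, j)\<in>?I. ?g i j * ?F ?m' i j)"
    by (rule prod_mono) (use fac in auto)
  also have "\<dots> = (\<Prod>(i, j)\<in>?I. ?g i j) * Dim n ?m'"
    unfolding Dim_def case_prod_unfold prod.distrib[symmetric] ..
  also have "(\<Prod>(i, j)\<in>?I. ?g i j) = (\<Prod>(i, j)\<in>{Suc k} \<times> {Suc k<..n}. ?g i j)"
    by (rule prod.mono_neutral_right[OF finI]) (auto split: if_splits)
  also have "\<dots> = (\<Prod>j\<in>{Suc k<..n}. ?g (Suc k) j)"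
    by (simp add: prod.cartesian_product[symmetric])
  also have "\<dots> = (\<Prod>d\<in>{1..n - Suc k}. (real a + real d) / real d)"
    by (rule prod.reindex_bij_witness[of _ "\<lambda>d. d + Suc k" "\<lambda>j. j - Suc k"]) auto
  also have "\<dots> * Dim n ?m' \<le> (\<Prod>d\<in>{1..n - 1}. (real a + real d) / real d) * Dim n ?m'"
    by (intro mult_right_mono prod_mono2 Dim') (auto simp: field_simps)
  also have "\<dots> = (\<Prod>j<a. (real n + real j) / (real j + 1)) * Dim n ?m'"
    unfolding prod_ratio_binomial using k by (simp add: of_nat_diff)
  finally show ?thesis .
qed

text \<open>The functional equation $\Gamma(x + 1) = x\,\Gamma(x)$, applied \<open>a\<close> times to both Gamma
  factors; no argument is a pole since \<open>z\<close> and \<open>w\<close> are not integers.\<close>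

lemma Gamma_weight_shift:
  fixes z w :: complex
  assumes z: "z \<notin> \<int>" and w: "w \<notin> \<int>"
  shows "(cmod (1 / (Gamma (z + 1 - of_nat a) * Gamma (w + of_nat n + of_nat a))))\<^sup>2
    = (cmod (1 / (Gamma (z + 1) * Gamma (w + of_nat n))))\<^sup>2 *
      (\<Prod>j<a. (cmod (z - of_nat j))\<^sup>2 / (cmod (w + of_nat n + of_nat j))\<^sup>2)"
proof (induction a)
  case (Suc a)
  have zi: "z - of_nat a \<notin> \<int>" using z Ints_add[of "z - of_nat a" "of_nat a"] by auto
  have wi: "w + of_nat n + of_nat a \<notin> \<int>"
    using w Ints_diff[of "w + of_nat n + of_nat a" "of_nat n + of_nat a"] by auto
  have z0: "z - of_nat a \<notin> \<int>\<^sub>\<le>\<^sub>0" "z - of_nat a \<noteq> 0" using zi nonpos_Ints_subset_Ints by auto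
  have w0: "w + of_nat n + of_nat a \<notin> \<int>\<^sub>\<le>\<^sub>0" "w + of_nat n + of_nat a \<noteq> 0"
    using wi nonpos_Ints_subset_Ints by (blast, metis Ints_0)
  have g1: "Gamma (z + 1 - of_nat a) = (z - of_nat a) * Gamma (z + 1 - of_nat (Suc a))"
    using Gamma_plus1[OF z0(1)] by (simp add: algebra_simps)
  have g2: "Gamma (w + of_nat n + of_nat (Suc a))
      = (w + of_nat n + of_nat a) * Gamma (w + of_nat n + of_nat a)"
    using Gamma_plus1[OF w0(1)] by (simp add: algebra_simps)
  have "(cmod (1 / (Gamma (z + 1 - of_nat (Suc a)) * Gamma (w + of_nat n + of_nat (Suc a)))))\<^sup>2
     = (cmod (1 / (Gamma (z + 1 - of_nat a) * Gamma (w + of_nat n + of_nat a))))\<^sup>2 *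
        ((cmod (z - of_nat a))\<^sup>2 / (cmod (w + of_nat n + of_nat a))\<^sup>2)"
    unfolding g1 g2 using z0 w0 by (simp add: norm_mult norm_divide power_mult_distrib power_divide)
  then show ?case unfolding Suc.IH by simp
qed simp

definition reset_ratio :: "complex \<Rightarrow> complex \<Rightarrow> nat \<Rightarrow> nat \<Rightarrow> real" where
  "reset_ratio z w n a = (\<Prod>j<a. ((cmod (z - of_nat j))\<^sup>2 / (cmod (w + of_nat n + of_nat j))\<^sup>2) *
     ((real n + real j) / (real j + 1)))"

lemma zw_S_nonneg: "zw_S z w n \<ge> 0"
  unfolding zw_S_def zw_weight_def by (intro infsum_nonneg mult_nonneg_nonneg prod_nonneg) auto

text \<open>One of the two dimension factors in the weight cancels against the denominator of
  \<open>zw_P\<close>, so the dimension enters to the first power only. This is decisive: the Gamma factors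
  gain $n^{-2}$ for \<open>a = 1\<close>, and one dimension loses only a factor \<open>n\<close>.\<close>

lemma zw_P_reset_le:
  assumes z: "z \<notin> \<int>" and w: "w \<notin> \<int>"
    and m: "m \<in> GT n" and k: "k < n"
    and mk: "coord m (Suc k) = int k + int a"
    and m': "m[k := int k] \<in> GT n"
    and right: "\<And>j. Suc k < j \<Longrightarrow> j \<le> n \<Longrightarrow> coord m j \<le> int k"
  shows "zw_P z w n m \<le> reset_ratio z w n a * zw_P z w n (m[k := int k])"
proof -
  let ?m' = "m[k := int k]"
  let ?g = "\<lambda>l i. (cmod (1 / (Gamma (z - of_int (coord l i) + of_nat i) *
        Gamma (w + of_nat n + 1 + of_int (coord l i) - of_nat i))))\<^sup>2"
  let ?G = "\<Prod>j<a. (cmod (z - of_nat j))\<^sup>2 / (cmod (w + of_nat n + of_nat j))\<^sup>2"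
  have len: "length m = n" using m by (simp add: GT_def)
  have P: "zw_P z w n l = (1 / zw_S z w n) * (\<Prod>i\<in>{1..n}. ?g l i) * Dim n l" if "l \<in> GT n" for l
    using Dim_pos[OF that] by (simp add: zw_P_def zw_M_def zw_weight_def power2_eq_square)
  have split: "(\<Prod>i\<in>{1..n}. ?g l i) = ?g l (Suc k) * (\<Prod>i\<in>{1..n} - {Suc k}. ?g l i)" for l
    by (rule prod.remove) (use k in auto)
  have rest: "(\<Prod>i\<in>{1..n} - {Suc k}. ?g ?m' i) = (\<Prod>i\<in>{1..n} - {Suc k}. ?g m i)"
    by (rule prod.cong) (use k len in \<open>auto simp: coord_update\<close>)
  have a1: "z - of_int (coord m (Suc k)) + of_nat (Suc k) = z + 1 - of_nat a"
    "w + of_nat n + 1 + of_int (coord m (Suc k)) - of_nat (Suc k) = w + of_nat n + of_nat a"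
    "z - of_int (coord ?m' (Suc k)) + of_nat (Suc k) = z + 1"
    "w + of_nat n + 1 + of_int (coord ?m' (Suc k)) - of_nat (Suc k) = w + of_nat n"
    using k len by (simp_all add: mk coord_update)
  have new: "?g m (Suc k) = ?g ?m' (Suc k) * ?G"
    unfolding a1 by (rule Gamma_weight_shift[OF z w])
  have nn: "0 \<le> (\<Prod>i\<in>{1..n}. ?g ?m' i)" "0 \<le> ?G" by (auto intro!: prod_nonneg)
  have w_eq: "(\<Prod>i\<in>{1..n}. ?g m i) = (\<Prod>i\<in>{1..n}. ?g ?m' i) * ?G"
    unfolding split rest new by (simp only: mult_ac)
  have "zw_P z w n m = (1 / zw_S z w n) * ((\<Prod>i\<in>{1..n}. ?g ?m' i) * ?G) * Dim n m"
    unfolding P[OF m] w_eq ..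
  also have "\<dots> \<le> (1 / zw_S z w n) * ((\<Prod>i\<in>{1..n}. ?g ?m' i) * ?G) *
      ((\<Prod>j<a. (real n + real j) / (real j + 1)) * Dim n ?m')"
    using Dim_reset_le[OF m k mk m' right] zw_S_nonneg[of z w n] nn
    by (intro mult_left_mono mult_nonneg_nonneg) auto
  also have "\<dots> = reset_ratio z w n a * zw_P z w n ?m'"
    unfolding P[OF m'] reset_ratio_def prod.distrib by (simp only: mult_ac)
  finally show ?thesis .
qed

section \<open>The cost of a new diagonal box is of order $1/n$\<close>

lemma reset_ratio_nonneg: "reset_ratio z w n a \<ge> 0"
  unfolding reset_ratio_def by (intro prod_nonneg) auto

text \<open>For \<open>n\<close> large, the \<open>j\<close>-th factor of the product is at most
  \<open>(j + c) / (j + c + 2)\<close> for a constant \<open>c\<close>, whence \<open>reset_ratio z w n (Suc a)\<close> is the first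
  factor times a telescoping product that decays like $a^{-2}$, and the sum over \<open>a\<close> telescopes as
  well. The first factor carries the \<open>1 / n\<close>.\<close>

lemma sum_reset_ratio_le:
  "\<exists>K n0. K > 0 \<and> (\<forall>n\<ge>n0. \<forall>m. (\<Sum>a<m. reset_ratio z w n (Suc a)) \<le> K / real n)"
proof -
  define A where "A = cmod z"
  define B where "B = cmod w"
  \<comment> \<open>The choice of \<open>c\<close> makes \<open>(A + j)\<^sup>2 \<le> (j + c) * (j + 1)\<close> true for all \<open>j\<close>; the summand \<open>1\<close>
      in \<open>K\<close> only makes it positive.\<close>
  define c where "c = 2 * A + A\<^sup>2"
  define K where "K = 2 * (A\<^sup>2 + 1) * (2 + c)"
  have A0: "A \<ge> 0" and B0: "B \<ge> 0" and c0: "c \<ge> 0" by (auto simp: A_def B_def c_def)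
  have "(\<Sum>a<m. reset_ratio z w n (Suc a)) \<le> K / real n" if n: "n \<ge> nat \<lceil>4 * B + c + 2\<rceil>" for n m
  proof -
    have n': "real n \<ge> 4 * B + c + 2" using n by linarith
    \<comment> \<open>The threshold for \<open>n\<close> serves twice: it gives \<open>n - 2 * B \<ge> c + 2\<close>, used in \<open>f_step\<close>, and
        \<open>n - 2 * B \<ge> n / 2\<close>, used in \<open>f_zero\<close>.\<close>
    define f where "f j = ((cmod (z - of_nat j))\<^sup>2 / (cmod (w + of_nat n + of_nat j))\<^sup>2) *
     ((real n + real j) / (real j + 1))" for j
    have f0: "f j \<ge> 0" for j by (simp add: f_def)
    have wn: "(cmod (w + of_nat n + of_nat j))\<^sup>2 \<ge> (real n + real j) * (real n + real j - 2 * B)" for j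
    proof -
      have "cmod (of_nat n + of_nat j :: complex) = real n + real j"
        by (metis norm_of_nat of_nat_add)
      then have "cmod (w + of_nat n + of_nat j) \<ge> real n + real j - B"
        using norm_triangle_ineq2[of "of_nat n + of_nat j" "- w"]
        by (simp add: B_def algebra_simps)
      then have "(cmod (w + of_nat n + of_nat j))\<^sup>2 \<ge> (real n + real j - B)\<^sup>2"
        using n' B0 c0 by (intro power_mono) auto
      moreover have "(real n + real j - B)\<^sup>2 \<ge> (real n + real j) * (real n + real j - 2 * B)"
        by (simp add: power2_eq_square algebra_simps)
      ultimately show ?thesis by linarith
    qed
    have f_le: "f j \<le> (cmod (z - of_nat j))\<^sup>2 / (real j + 1) / (real n + real j - 2 * B)" for j
    proof -
      have p: "real n + real j > 0" "real n + real j - 2 * B > 0" using n' B0 c0 by auto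
      have "f j = ((cmod (z - of_nat j))\<^sup>2 * (real n + real j) / (real j + 1)) / (cmod (w + of_nat n + of_nat j))\<^sup>2"
        by (simp add: f_def)
      also have "\<dots> \<le> ((cmod (z - of_nat j))\<^sup>2 * (real n + real j) / (real j + 1)) /
          ((real n + real j) * (real n + real j - 2 * B))"
      proof (rule divide_left_mono)
        have pos: "0 < (real n + real j) * (real n + real j - 2 * B)" using p by simp
        show "0 < (cmod (w + of_nat n + of_nat j))\<^sup>2 * ((real n + real j) * (real n + real j - 2 * B))"
          by (intro mult_pos_pos pos less_le_trans[OF pos wn])
      qed (use wn p in auto)
      also have "\<dots> = (cmod (z - of_nat j))\<^sup>2 / (real j + 1) / (real n + real j - 2 * B)"
      proof -
        have "x * r / d / (r * q) = x / d / q" if "r \<noteq> 0" for x r d q :: real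
          using that by simp
        then show ?thesis using p by simp
      qed
      finally show ?thesis .
    qed
    have f_zero: "f 0 \<le> 2 * (A\<^sup>2 + 1) / real n"
    proof -
      have "f 0 \<le> A\<^sup>2 / (real n - 2 * B)" using f_le[of 0] by (simp add: A_def)
      also have "\<dots> \<le> (A\<^sup>2 + 1) / (real n / 2)"
        using n' B0 c0 by (intro frac_le) auto
      finally show ?thesis by (simp add: field_simps)
    qed
    have f_step: "f j \<le> (real j + c) / (real j + c + 2)" for j
    proof -
      have "cmod (z - of_nat j) \<le> A + real j"
        using norm_triangle_ineq4[of z "of_nat j"] by (simp add: A_def)
      then have "(cmod (z - of_nat j))\<^sup>2 \<le> (A + real j)\<^sup>2" by (intro power_mono) auto
      also have "\<dots> \<le> (real j + c) * (real j + 1)"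
        using A0 by (simp add: c_def power2_eq_square algebra_simps)
      finally have "(cmod (z - of_nat j))\<^sup>2 / (real j + 1) \<le> real j + c"
        by (simp add: field_simps)
      then have "(cmod (z - of_nat j))\<^sup>2 / (real j + 1) / (real n + real j - 2 * B)
          \<le> (real j + c) / (real j + c + 2)"
        using n' B0 c0 by (intro frac_le) auto
      then show ?thesis using f_le[of j] by linarith
    qed
    have r_le: "reset_ratio z w n (Suc a) \<le> f 0 * ((1 + c) * (2 + c) / ((real a + 1 + c) * (real a + 2 + c)))" for a
    proof (induction a)
      case 0
      then show ?case using c0 by (simp add: reset_ratio_def f_def)
    next
      case (Suc a)
      have "reset_ratio z w n (Suc (Suc a)) = reset_ratio z w n (Suc a) * f (Suc a)"
        by (simp add: reset_ratio_def f_def)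
      also have "\<dots> \<le> (f 0 * ((1 + c) * (2 + c) / ((real a + 1 + c) * (real a + 2 + c)))) *
          ((real (Suc a) + c) / (real (Suc a) + c + 2))"
        by (rule mult_mono[OF Suc f_step]) (use f0 c0 reset_ratio_nonneg in auto)
      also have "\<dots> = f 0 * ((1 + c) * (2 + c) / ((real (Suc a) + 1 + c) * (real (Suc a) + 2 + c)))"
        using c0 by (simp add: divide_simps) (simp add: algebra_simps)
      finally show ?case .
    qed
    have tel: "(\<Sum>a<m. 1 / ((real a + 1 + c) * (real a + 2 + c))) = 1 / (1 + c) - 1 / (real m + 1 + c)"
    proof (induction m)
      case (Suc m)
      have "1 / ((real m + 1 + c) * (real m + 2 + c)) = 1 / (real m + 1 + c) - 1 / (real m + 2 + c)"
        using c0 by (simp add: divide_simps)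
      then show ?case using Suc by (simp add: algebra_simps)
    qed simp
    have "(\<Sum>a<m. reset_ratio z w n (Suc a))
        \<le> (\<Sum>a<m. f 0 * ((1 + c) * (2 + c) / ((real a + 1 + c) * (real a + 2 + c))))"
      by (intro sum_mono r_le)
    also have "\<dots> = f 0 * ((1 + c) * (2 + c)) * (1 / (1 + c) - 1 / (real m + 1 + c))"
      unfolding tel[symmetric] sum_distrib_left by (simp add: mult_ac)
    also have "\<dots> \<le> f 0 * ((1 + c) * (2 + c)) * (1 / (1 + c))"
      using c0 f0[of 0] by (intro mult_left_mono mult_nonneg_nonneg) auto
    also have "\<dots> = f 0 * (2 + c)" using c0 by simp
    also have "\<dots> \<le> 2 * (A\<^sup>2 + 1) / real n * (2 + c)"
      using f_zero c0 by (intro mult_right_mono) auto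
    finally show ?thesis by (simp add: K_def)
  qed
  moreover have "K > 0" using c0 unfolding K_def
    by (intro mult_pos_pos) (auto intro: add_nonneg_pos)
  ultimately show ?thesis by blast
qed

section \<open>From the step bound to polynomial moments\<close>

text \<open>Think of \<open>p n k\<close> as the probability that a counter at time \<open>n\<close> has the value \<open>k\<close>; the
  hypotheses say that from time \<open>n0\<close> on it moves up by at most one, and at time \<open>n\<close> with
  conditional probability at most \<open>K / (n + 1)\<close>. The sum is the expectation of \<open>2\<close> to the power of the counter. Each step
  multiplies it by at most \<open>1 + 2 * K / (n + 1)\<close>, and a product of such factors grows like a
  power of \<open>n\<close>.\<close>

lemma polynomial_growth:
  fixes p :: "nat \<Rightarrow> nat \<Rightarrow> real" and K :: real
  assumes nonneg: "\<And>n k. 0 \<le> p n k" and supp: "\<And>n k. n < k \<Longrightarrow> p n k = 0"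
    and p0: "\<And>n. n \<ge> n0 \<Longrightarrow> p (Suc n) 0 \<le> p n 0"
    and step: "\<And>n k. n \<ge> n0 \<Longrightarrow> p (Suc n) (Suc k) \<le> p n (Suc k) + K / real (Suc n) * p n k"
    and K: "K > 0"
  shows "\<exists>D. \<forall>n\<ge>Suc n0. (\<Sum>k\<le>n. 2 ^ k * p n k) \<le> D * real n ^ nat \<lceil>2 * K\<rceil>"
proof -
  define e where "e n = (\<Sum>k\<le>n. 2 ^ k * p n k)" for n
  define r where "r = nat \<lceil>2 * K\<rceil>"
  have r: "2 * K \<le> real r" unfolding r_def by linarith
  have e0: "e n \<ge> 0" for n unfolding e_def by (intro sum_nonneg) (use nonneg in auto)
  have e_step: "e (Suc n) \<le> (1 + 2 * K / real (Suc n)) * e n" if n: "n \<ge> n0" for n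
  proof -
    have "e (Suc n) = p (Suc n) 0 + (\<Sum>k\<le>n. 2 ^ Suc k * p (Suc n) (Suc k))"
      unfolding e_def by (subst sum.atMost_Suc_shift) simp
    also have "\<dots> \<le> p n 0 + (\<Sum>k\<le>n. 2 ^ Suc k * (p n (Suc k) + K / real (Suc n) * p n k))"
      by (intro add_mono p0 sum_mono mult_left_mono step n) auto
    also have "\<dots> = (p n 0 + (\<Sum>k\<le>n. 2 ^ Suc k * p n (Suc k))) + 2 * K / real (Suc n) * e n"
      unfolding e_def distrib_left sum.distrib sum_distrib_left by (simp add: mult_ac)
    also have "p n 0 + (\<Sum>k\<le>n. 2 ^ Suc k * p n (Suc k)) = (\<Sum>k\<le>Suc n. 2 ^ k * p n k)"
      by (subst sum.atMost_Suc_shift) simp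
    also have "\<dots> = e n" by (simp add: e_def supp)
    finally show ?thesis by (simp add: algebra_simps)
  qed
  have "e n \<le> e (Suc n0) * real n ^ r" if "n \<ge> Suc n0" for n
    using that
  proof (induction n rule: dec_induct)
    case base
    have "(1::real) \<le> real (Suc n0) ^ r" by (intro one_le_power) auto
    then show ?case using mult_left_mono[of 1 "real (Suc n0) ^ r" "e (Suc n0)"] e0[of "Suc n0"]
      by simp
  next
    case (step n)
    have n: "real n > 0" using step by simp
    have "1 + 2 * K / real (Suc n) \<le> 1 + real r * (1 / real n)"
      using r K n by (auto intro!: frac_le)
    also have "\<dots> \<le> (1 + 1 / real n) ^ r"
      by (rule Bernoulli_inequality) (use n in \<open>auto intro: order_trans[of _ 0]\<close>)
    finally have b: "1 + 2 * K / real (Suc n) \<le> (1 + 1 / real n) ^ r" .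
    have "e (Suc n) \<le> (1 + 2 * K / real (Suc n)) * e n" using e_step step by simp
    also have "\<dots> \<le> (1 + 1 / real n) ^ r * (e (Suc n0) * real n ^ r)"
      using b step e0[of n] by (intro mult_mono) auto
    also have "\<dots> = e (Suc n0) * ((1 + 1 / real n) * real n) ^ r"
      by (simp add: power_mult_distrib)
    also have "(1 + 1 / real n) * real n = real (Suc n)" using n by (simp add: field_simps)
    finally show ?case .
  qed
  then show ?thesis unfolding e_def r_def by blast
qed

section \<open>Events and cylinders\<close>

lemma s_tilde_le: "\<tau> \<in> paths \<Longrightarrow> s_tilde n \<tau> \<le> n"
  using diag_le[of "\<tau> n" n] by (simp add: paths_def s_tilde_def)

lemma finite_path_in_path_base: "finite_path n t \<Longrightarrow> cylinder n t \<in> path_base"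
  by (auto simp: path_base_def)

text \<open>Finite paths of length \<open>n\<close> are represented by functions that are undefined off
  \<open>{1..n}\<close>, so that distinct ones have disjoint cylinders and there are countably many.\<close>

lemma countable_level_restrictions: "countable (PiE {1..n::nat} (\<lambda>_. UNIV :: int list set))"
  by (rule countable_PiE) simp_all

lemma disjoint_cylinders:
  assumes "T \<subseteq> PiE {1..n} (\<lambda>_. UNIV)"
  shows "disjoint_family_on (cylinder n) T"
  unfolding disjoint_family_on_def
proof (intro ballI impI)
  fix t t' assume "t \<in> T" "t' \<in> T" "t \<noteq> t'"
  then obtain k where "k \<in> {1..n}" "t k \<noteq> t' k"
    using assms PiE_ext[of t "{1..n}" "\<lambda>_. UNIV" t'] by blast
  then show "cylinder n t \<inter> cylinder n t' = {}" unfolding cylinder_def by auto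
qed

lemma paths_finite_path:
  assumes "\<tau> \<in> paths" "1 \<le> n"
  shows "finite_path n (restrict \<tau> {1..n})"
  using assms by (auto simp: paths_def finite_path_def)

text \<open>The measure is known only on cylinders of whole finite paths, so an event that depends on
  the first \<open>n\<close> levels is cut into these.\<close>

lemma event_eq_cylinders:
  assumes Q: "\<And>\<tau> \<tau>'. (\<And>k. k \<in> {1..n} \<Longrightarrow> \<tau> k = \<tau>' k) \<Longrightarrow> Q \<tau> = Q \<tau>'" and n: "1 \<le> n"
  shows "{\<tau> \<in> paths. Q \<tau>} = (\<Union>t\<in>{t \<in> PiE {1..n} (\<lambda>_. UNIV). finite_path n t \<and> Q t}. cylinder n t)"
    (is "?L = ?R")
proof
  show "?L \<subseteq> ?R"
  proof clarify
    fix \<tau> assume t: "\<tau> \<in> paths" "Q \<tau>"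
    have "Q (restrict \<tau> {1..n})" using t(2) Q[of "restrict \<tau> {1..n}" \<tau>] by simp
    moreover have "\<tau> \<in> cylinder n (restrict \<tau> {1..n})" using t by (simp add: cylinder_def)
    ultimately show "\<tau> \<in> ?R"
      using paths_finite_path[OF t(1) n] by (intro UN_I[of "restrict \<tau> {1..n}"]) auto
  qed
  show "?R \<subseteq> ?L"
  proof clarify
    fix \<tau> t assume "Q t" "\<tau> \<in> cylinder n t"
    then show "\<tau> \<in> paths \<and> Q \<tau>" using Q[of \<tau> t] by (auto simp: cylinder_def)
  qed
qed

section \<open>Tail bounds under the $(z,w)$-measure\<close>

context
  fixes z w :: complex and \<rho> :: "(nat \<Rightarrow> int list) measure"
  assumes zw: "is_zw_measure z w \<rho>"
begin

lemma sets_zw: "sets \<rho> = sigma_sets paths path_base"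
  using zw by (simp add: is_zw_measure_def sets_path_borel)

lemma space_zw: "space \<rho> = paths"
  using zw sets_eq_imp_space_eq[of \<rho> path_borel] by (simp add: is_zw_measure_def space_path_borel)

lemma cylinder_measurable: "finite_path n t \<Longrightarrow> cylinder n t \<in> sets \<rho>"
  unfolding sets_zw by (intro sigma_sets.Basic finite_path_in_path_base)

lemma event_measurable:
  assumes "\<And>\<tau> \<tau>'. (\<And>k. k \<in> {1..n} \<Longrightarrow> \<tau> k = \<tau>' k) \<Longrightarrow> Q \<tau> = Q \<tau>'" and "1 \<le> n"
  shows "{\<tau> \<in> paths. Q \<tau>} \<in> sets \<rho>"
proof -
  have "countable {t \<in> PiE {1..n} (\<lambda>_. UNIV). finite_path n t \<and> Q t}"
    by (rule countable_subset[OF _ countable_level_restrictions]) auto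
  then have "(\<Union>t\<in>{t \<in> PiE {1..n} (\<lambda>_. UNIV). finite_path n t \<and> Q t}. cylinder n t) \<in> sets \<rho>"
    by (intro sets.countable_UN'') (auto intro: cylinder_measurable)
  then show ?thesis using event_eq_cylinders[of n Q, OF assms] by simp
qed

text \<open>Transport of a pointwise comparison along an injection: each cylinder
  is charged to its target under \<open>g\<close>, and no target is charged twice.\<close>

lemma measure_cylinders_le:
  assumes T: "T \<subseteq> PiE {1..n} (\<lambda>_. UNIV)" and gT: "g ` T \<subseteq> PiE {1..n} (\<lambda>_. UNIV)"
    and inj: "inj_on g T" and fp: "\<And>t. t \<in> T \<Longrightarrow> finite_path n t" "\<And>t. t \<in> T \<Longrightarrow> finite_path n (g t)"
    and le: "\<And>t. t \<in> T \<Longrightarrow> measure \<rho> (cylinder n t) \<le> r * measure \<rho> (cylinder n (g t))"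
    and r: "0 \<le> r"
  shows "measure \<rho> (\<Union>t\<in>T. cylinder n t) \<le> r * measure \<rho> (\<Union>t\<in>g ` T. cylinder n t)"
proof -
  interpret prob_space \<rho> using zw by (simp add: is_zw_measure_def)
  have cT: "countable T" "countable (g ` T)"
    using countable_subset[OF T countable_level_restrictions] by auto
  have "emeasure \<rho> (\<Union>t\<in>T. cylinder n t) = (\<integral>\<^sup>+t. emeasure \<rho> (cylinder n t) \<partial>count_space T)"
    by (intro emeasure_UN_countable cT disjoint_cylinders T cylinder_measurable fp)
  also have "\<dots> \<le> (\<integral>\<^sup>+t. ennreal r * emeasure \<rho> (cylinder n (g t)) \<partial>count_space T)"
    by (rule nn_integral_mono) (use le r in \<open>simp add: emeasure_eq_measure ennreal_mult'[symmetric] ennreal_leI\<close>)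
  also have "\<dots> = ennreal r * (\<integral>\<^sup>+t. emeasure \<rho> (cylinder n (g t)) \<partial>count_space T)"
    by (rule nn_integral_cmult) simp
  also have "(\<integral>\<^sup>+t. emeasure \<rho> (cylinder n (g t)) \<partial>count_space T)
      = (\<integral>\<^sup>+t. emeasure \<rho> (cylinder n t) \<partial>count_space (g ` T))"
    using inj by (intro nn_integral_bij_count_space) (simp add: bij_betw_def)
  also have "\<dots> = emeasure \<rho> (\<Union>t\<in>g ` T. cylinder n t)"
    by (rule emeasure_UN_countable[symmetric]) (use cT disjoint_cylinders[OF gT] cylinder_measurable fp in auto)
  finally show ?thesis
    using r by (simp add: emeasure_eq_measure ennreal_mult'[symmetric])
qed

text \<open>For \<open>k\<close> and \<open>a\<close> fixed, the reset at level \<open>Suc n\<close> is injective, since the erased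
  coordinate is known to be \<open>k + a\<close>, and it does not change the levels up to \<open>n\<close>. Hence all targets
  lie in the event \<open>s_tilde n \<tau> = k\<close>.\<close>

lemma measure_increment_le:
  assumes z: "z \<notin> \<int>" and w: "w \<notin> \<int>" and n: "1 \<le> n"
  shows "measure \<rho> {\<tau> \<in> paths. s_tilde n \<tau> = k \<and> s_tilde (Suc n) \<tau> = Suc k \<and>
             coord (\<tau> (Suc n)) (Suc k) = int k + int a}
       \<le> reset_ratio z w (Suc n) a * measure \<rho> {\<tau> \<in> paths. s_tilde n \<tau> = k}"
proof -
  interpret prob_space \<rho> using zw by (simp add: is_zw_measure_def)
  let ?Q = "\<lambda>\<tau>. s_tilde n \<tau> = k \<and> s_tilde (Suc n) \<tau> = Suc k \<and> coord (\<tau> (Suc n)) (Suc k) = int k + int a"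
  define T where "T = {t \<in> PiE {1..Suc n} (\<lambda>_. UNIV). finite_path (Suc n) t \<and> ?Q t}"
  define g where "g t = t(Suc n := (t (Suc n))[k := int k])" for t :: "nat \<Rightarrow> int list"
  have T: "T \<subseteq> PiE {1..Suc n} (\<lambda>_. UNIV)" by (auto simp: T_def)
  have gT: "g ` T \<subseteq> PiE {1..Suc n} (\<lambda>_. UNIV)"
    by (auto simp: T_def g_def PiE_def extensional_def)
  have T_facts: "finite_path (Suc n) (g t)"
    "zw_P z w (Suc n) (t (Suc n)) \<le> reset_ratio z w (Suc n) a * zw_P z w (Suc n) (g t (Suc n))"
    "k < length (t (Suc n))"
    if "t \<in> T" for t
  proof -
    have t: "finite_path (Suc n) t" "?Q t" using that by (auto simp: T_def)
    have lm: "t n \<in> GT n" "t (Suc n) \<in> GT (Suc n)" "interlaces (t n) (t (Suc n))"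
      using t(1) n by (auto simp: finite_path_def)
    have d: "diag (t n) = k" "diag (t (Suc n)) = Suc (diag (t n))" using t(2) by (auto simp: s_tilde_def)
    note reset = reset_new_diagonal_box[OF lm d(2), unfolded d(1)]
    show "finite_path (Suc n) (g t)"
      using t(1) reset(1,2) unfolding finite_path_def g_def by (auto simp: less_Suc_eq)
    show "zw_P z w (Suc n) (t (Suc n)) \<le> reset_ratio z w (Suc n) a * zw_P z w (Suc n) (g t (Suc n))"
      unfolding g_def fun_upd_same
      by (rule zw_P_reset_le[OF z w lm(2)]) (use reset t(2) in auto)
    show "k < length (t (Suc n))" using lm(2) reset(4) by (simp add: GT_def)
  qed
  have inj: "inj_on g T"
  proof (rule inj_onI)
    fix t t' assume t: "t \<in> T" "t' \<in> T" and eq: "g t = g t'"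
    have "t (Suc n) ! k = t' (Suc n) ! k"
      using t by (auto simp: T_def coord_def)
    moreover have "(t (Suc n))[k := int k] = (t' (Suc n))[k := int k]"
      using fun_cong[OF eq, of "Suc n"] by (simp add: g_def)
    ultimately have "t (Suc n) = t' (Suc n)"
      by (metis list_update_id list_update_overwrite)
    moreover have "t j = t' j" if "j \<noteq> Suc n" for j
      using fun_cong[OF eq, of j] that by (simp add: g_def)
    ultimately show "t = t'" by (metis ext)
  qed
  have "{\<tau> \<in> paths. ?Q \<tau>} = (\<Union>t\<in>T. cylinder (Suc n) t)"
    unfolding T_def by (rule event_eq_cylinders) (use n in \<open>auto simp: s_tilde_def\<close>)
  also have "measure \<rho> \<dots> \<le> reset_ratio z w (Suc n) a * measure \<rho> (\<Union>t\<in>g ` T. cylinder (Suc n) t)"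
  proof (rule measure_cylinders_le[OF T gT inj])
    fix t assume t: "t \<in> T"
    then have "finite_path (Suc n) t" by (simp add: T_def)
    then show "measure \<rho> (cylinder (Suc n) t) \<le> reset_ratio z w (Suc n) a * measure \<rho> (cylinder (Suc n) (g t))"
      using T_facts[OF t] zw by (simp add: is_zw_measure_def)
  qed (use T_facts reset_ratio_nonneg in \<open>auto simp: T_def\<close>)
  also have "\<dots> \<le> reset_ratio z w (Suc n) a * measure \<rho> {\<tau> \<in> paths. s_tilde n \<tau> = k}"
  proof (intro mult_left_mono finite_measure_mono reset_ratio_nonneg)
    show "(\<Union>t\<in>g ` T. cylinder (Suc n) t) \<subseteq> {\<tau> \<in> paths. s_tilde n \<tau> = k}"
      using n by (auto simp: cylinder_def T_def g_def s_tilde_def)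
    show "{\<tau> \<in> paths. s_tilde n \<tau> = k} \<in> sets \<rho>"
      using n by (intro event_measurable[of n]) (auto simp: s_tilde_def)
  qed
  finally show ?thesis .
qed

lemma measure_all_increments_le:
  assumes z: "z \<notin> \<int>" and w: "w \<notin> \<int>" and n: "1 \<le> n"
    and R: "\<And>m. (\<Sum>a<m. reset_ratio z w (Suc n) (Suc a)) \<le> R"
  shows "measure \<rho> {\<tau> \<in> paths. s_tilde n \<tau> = k \<and> s_tilde (Suc n) \<tau> = Suc k}
       \<le> R * measure \<rho> {\<tau> \<in> paths. s_tilde n \<tau> = k}"
proof -
  interpret prob_space \<rho> using zw by (simp add: is_zw_measure_def)
  define E where "E a = {\<tau> \<in> paths. s_tilde n \<tau> = k \<and> s_tilde (Suc n) \<tau> = Suc k \<and>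
             coord (\<tau> (Suc n)) (Suc k) = int k + int (Suc a)}" for a
  have "{\<tau> \<in> paths. s_tilde n \<tau> = k \<and> s_tilde (Suc n) \<tau> = Suc k} \<subseteq> (\<Union>a. E a)"
  proof clarify
    fix \<tau> assume t: "\<tau> \<in> paths" "k = s_tilde n \<tau>" "s_tilde (Suc n) \<tau> = Suc (s_tilde n \<tau>)"
    have "int (Suc k) \<le> coord (\<tau> (Suc n)) (Suc k)"
      using reset_new_diagonal_box(5)[of "\<tau> n" n "\<tau> (Suc n)"] t by (auto simp: paths_def s_tilde_def)
    then have "coord (\<tau> (Suc n)) (Suc k) = int k + int (Suc (nat (coord (\<tau> (Suc n)) (Suc k) - int (Suc k))))"
      by simp
    then show "\<tau> \<in> (\<Union>a. E a)" using t unfolding E_def by blast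
  qed
  then have U: "{\<tau> \<in> paths. s_tilde n \<tau> = k \<and> s_tilde (Suc n) \<tau> = Suc k} = (\<Union>a. E a)"
    by (auto simp: E_def)
  have "E a \<in> sets \<rho>" for a
    unfolding E_def by (rule event_measurable[of "Suc n"]) (use n in \<open>auto simp: s_tilde_def\<close>)
  then have meas: "range E \<subseteq> sets \<rho>" by blast
  have "disjoint_family E" by (auto simp: disjoint_family_on_def E_def)
  then have sums: "(\<lambda>a. measure \<rho> (E a)) sums measure \<rho> (\<Union>a. E a)"
    by (rule finite_measure_UNION[OF meas])
  have "(\<Sum>a<m. measure \<rho> (E a)) \<le> R * measure \<rho> {\<tau> \<in> paths. s_tilde n \<tau> = k}" for m
  proof -
    have "(\<Sum>a<m. measure \<rho> (E a))
        \<le> (\<Sum>a<m. reset_ratio z w (Suc n) (Suc a) * measure \<rho> {\<tau> \<in> paths. s_tilde n \<tau> = k})"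
      unfolding E_def by (intro sum_mono measure_increment_le z w n)
    also have "\<dots> \<le> R * measure \<rho> {\<tau> \<in> paths. s_tilde n \<tau> = k}"
      unfolding sum_distrib_right[symmetric] by (intro mult_right_mono R) simp
    finally show ?thesis .
  qed
  from suminf_le_const[OF sums_summable[OF sums] this] show ?thesis
    unfolding U sums_unique[OF sums] .
qed

text \<open>By Markov's inequality for \<open>2\<close> to the power \<open>s_tilde n\<close>, which is compared with
  $n^{r+2} = 2^{(r+2) \ln n / \ln 2}$, the exceptional events have probability
  $O(n^{-2})$, and Borel--Cantelli applies.\<close>

lemma AE_s_tilde_less_log:
  assumes growth: "\<And>n. n \<ge> n0 \<Longrightarrow> (\<Sum>k\<le>n. 2 ^ k * measure \<rho> {\<tau> \<in> paths. s_tilde n \<tau> = k}) \<le> D * real n ^ r"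
  shows "AE \<tau> in \<rho>. \<forall>\<^sub>F n in sequentially. real (s_tilde n \<tau>) < real (r + 2) / ln 2 * ln (real n)"
proof -
  interpret prob_space \<rho> using zw by (simp add: is_zw_measure_def)
  let ?C = "real (r + 2) / ln 2"
  \<comment> \<open>The events are made empty for small \<open>n\<close>: cylinders do not see level \<open>0\<close>, and the growth bound starts at \<open>n0\<close>.\<close>
  define N where "N = max 1 n0"
  define B where "B n = (if n \<ge> N then {\<tau> \<in> paths. ?C * ln (real n) \<le> real (s_tilde n \<tau>)} else {})" for n
  have p_meas: "{\<tau> \<in> paths. s_tilde n \<tau> = k} \<in> sets \<rho>" if "n \<ge> N" for n k
    using that by (intro event_measurable[of n]) (auto simp: s_tilde_def N_def)
  have B_meas: "B n \<in> sets \<rho>" for n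
  proof (cases "n \<ge> N")
    case True
    have "{\<tau> \<in> paths. ?C * ln (real n) \<le> real (s_tilde n \<tau>)} \<in> sets \<rho>"
      by (rule event_measurable[of n]) (use True in \<open>auto simp: s_tilde_def N_def\<close>)
    then show ?thesis using True by (simp add: B_def)
  qed (simp add: B_def)
  have B_le: "measure \<rho> (B n) \<le> D * inverse (real n ^ 2)" if n: "n \<ge> N" for n
  proof -
    have n1: "n \<ge> 1" using n by (simp add: N_def)
    let ?J = "{k. k \<le> n \<and> ?C * ln (real n) \<le> real k}"
    let ?p = "\<lambda>k. measure \<rho> {\<tau> \<in> paths. s_tilde n \<tau> = k}"
    have "B n \<subseteq> (\<Union>k\<in>?J. {\<tau> \<in> paths. s_tilde n \<tau> = k})"
      using n s_tilde_le[of _ n] by (auto simp: B_def)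
    then have "measure \<rho> (B n) \<le> measure \<rho> (\<Union>k\<in>?J. {\<tau> \<in> paths. s_tilde n \<tau> = k})"
      by (intro finite_measure_mono sets.finite_UN) (auto intro: p_meas n)
    also have "\<dots> \<le> (\<Sum>k\<in>?J. ?p k)"
      by (intro finite_measure_subadditive_finite) (auto intro: p_meas n)
    also have "\<dots> \<le> (\<Sum>k\<in>?J. 2 ^ k * ?p k * inverse (real n ^ (r + 2)))"
    proof (rule sum_mono)
      fix k assume "k \<in> ?J"
      then have "real (r + 2) * ln (real n) \<le> ln 2 * real k"
        by (simp add: field_simps)
      then have "exp (real (r + 2) * ln (real n)) \<le> exp (ln 2 * real k)" by simp
      also have "exp (ln 2 * real k) = 2 ^ k" by (simp add: exp_of_nat2_mult)
      also have "exp (real (r + 2) * ln (real n)) = real n ^ (r + 2)"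
        using n1 by (simp only: exp_of_nat_mult exp_ln)
      finally have "1 \<le> 2 ^ k * inverse (real n ^ (r + 2))" using n1 by (simp add: field_simps)
      then have "?p k * 1 \<le> ?p k * (2 ^ k * inverse (real n ^ (r + 2)))"
        by (intro mult_left_mono) auto
      then show "?p k \<le> 2 ^ k * ?p k * inverse (real n ^ (r + 2))" by (simp add: mult_ac)
    qed
    also have "\<dots> \<le> (\<Sum>k\<le>n. 2 ^ k * ?p k * inverse (real n ^ (r + 2)))"
      by (intro sum_mono2) auto
    also have "\<dots> = (\<Sum>k\<le>n. 2 ^ k * ?p k) * inverse (real n ^ (r + 2))"
      by (rule sum_distrib_right[symmetric])
    also have "\<dots> \<le> (D * real n ^ r) * inverse (real n ^ (r + 2))"
      using n by (intro mult_right_mono growth) (auto simp: N_def)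
    also have "\<dots> = D * inverse (real n ^ 2)"
      using n1 by (simp add: power_add field_simps power2_eq_square)
    finally show ?thesis .
  qed
  have "summable (\<lambda>n. measure \<rho> (B n))"
  proof (rule summable_comparison_test)
    show "summable (\<lambda>n. D * inverse (real n ^ 2))"
      by (intro summable_mult inverse_power_summable) simp
    show "\<exists>M. \<forall>n\<ge>M. norm (measure \<rho> (B n)) \<le> D * inverse (real n ^ 2)"
      using B_le by (intro exI[of _ N]) simp
  qed
  then have "AE \<tau> in \<rho>. \<forall>\<^sub>F n in sequentially. \<tau> \<in> space \<rho> - B n"
    using B_meas by (intro borel_cantelli_AE1) (auto simp: emeasure_eq_measure)
  then show ?thesis
  proof eventually_elim
    case (elim \<tau>)
    then show ?case using eventually_ge_at_top[of N]
      by eventually_elim (auto simp: B_def space_zw)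
  qed
qed

lemma moment_growth:
  assumes z: "z \<notin> \<int>" and w: "w \<notin> \<int>" and K: "K > 0"
    and R: "\<And>n m. n \<ge> n0 \<Longrightarrow> (\<Sum>a<m. reset_ratio z w n (Suc a)) \<le> K / real n"
  shows "\<exists>D. \<forall>n\<ge>Suc (max 1 n0). (\<Sum>k\<le>n. 2 ^ k * measure \<rho> {\<tau> \<in> paths. s_tilde n \<tau> = k}) \<le> D * real n ^ nat \<lceil>2 * K\<rceil>"
proof (rule polynomial_growth[OF _ _ _ _ K, where p = "\<lambda>n k. measure \<rho> {\<tau> \<in> paths. s_tilde n \<tau> = k}"])
  interpret prob_space \<rho> using zw by (simp add: is_zw_measure_def)
  have grow: "s_tilde (Suc n) \<tau> = s_tilde n \<tau> \<or> s_tilde (Suc n) \<tau> = Suc (s_tilde n \<tau>)" if "\<tau> \<in> paths" for n \<tau>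
    using diag_interlaces[of "\<tau> n" n "\<tau> (Suc n)"] that by (auto simp: paths_def s_tilde_def)
  have meas: "{\<tau> \<in> paths. Q (s_tilde n \<tau>) (s_tilde (Suc n) \<tau>)} \<in> sets \<rho>" if "1 \<le> n" for n Q
    using that by (intro event_measurable[of "Suc n"]) (auto simp: s_tilde_def)
  fix n k
  show "0 \<le> measure \<rho> {\<tau> \<in> paths. s_tilde n \<tau> = k}" by simp
  show "measure \<rho> {\<tau> \<in> paths. s_tilde n \<tau> = k} = 0" if "n < k"
  proof -
    have "{\<tau> \<in> paths. s_tilde n \<tau> = k} = {}"
      using that s_tilde_le[of _ n] by (auto simp: not_le[symmetric])
    then show ?thesis by (simp only: measure_empty)
  qed
  assume n: "n \<ge> max 1 n0"
  show "measure \<rho> {\<tau> \<in> paths. s_tilde (Suc n) \<tau> = 0} \<le> measure \<rho> {\<tau> \<in> paths. s_tilde n \<tau> = 0}"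
  proof (rule finite_measure_mono)
    show "{\<tau> \<in> paths. s_tilde (Suc n) \<tau> = 0} \<subseteq> {\<tau> \<in> paths. s_tilde n \<tau> = 0}"
    proof clarify
      fix \<tau> assume "\<tau> \<in> paths" "s_tilde (Suc n) \<tau> = 0"
      then show "s_tilde n \<tau> = 0" using grow[of \<tau> n] by auto
    qed
    show "{\<tau> \<in> paths. s_tilde n \<tau> = 0} \<in> sets \<rho>"
      using meas[of n "\<lambda>x y. x = 0"] n by simp
  qed
  have "measure \<rho> {\<tau> \<in> paths. s_tilde (Suc n) \<tau> = Suc k}
      \<le> measure \<rho> ({\<tau> \<in> paths. s_tilde n \<tau> = Suc k} \<union> {\<tau> \<in> paths. s_tilde n \<tau> = k \<and> s_tilde (Suc n) \<tau> = Suc k})"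
  proof (rule finite_measure_mono)
    show "{\<tau> \<in> paths. s_tilde (Suc n) \<tau> = Suc k}
        \<subseteq> {\<tau> \<in> paths. s_tilde n \<tau> = Suc k} \<union> {\<tau> \<in> paths. s_tilde n \<tau> = k \<and> s_tilde (Suc n) \<tau> = Suc k}"
    proof
      fix \<tau> assume "\<tau> \<in> {\<tau> \<in> paths. s_tilde (Suc n) \<tau> = Suc k}"
      then show "\<tau> \<in> {\<tau> \<in> paths. s_tilde n \<tau> = Suc k} \<union> {\<tau> \<in> paths. s_tilde n \<tau> = k \<and> s_tilde (Suc n) \<tau> = Suc k}"
        using grow[of \<tau> n] by auto
    qed
  qed (use meas[of n "\<lambda>x y. x = Suc k"] meas[of n "\<lambda>x y. x = k \<and> y = Suc k"] n in simp)
  also have "\<dots> \<le> measure \<rho> {\<tau> \<in> paths. s_tilde n \<tau> = Suc k} + measure \<rho> {\<tau> \<in> paths. s_tilde n \<tau> = k \<and> s_tilde (Suc n) \<tau> = Suc k}"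
    using meas[of n "\<lambda>x y. x = Suc k"] meas[of n "\<lambda>x y. x = k \<and> y = Suc k"] n
    by (intro measure_Un_le) auto
  also have "measure \<rho> {\<tau> \<in> paths. s_tilde n \<tau> = k \<and> s_tilde (Suc n) \<tau> = Suc k}
      \<le> K / real (Suc n) * measure \<rho> {\<tau> \<in> paths. s_tilde n \<tau> = k}"
    using n by (intro measure_all_increments_le z w R) auto
  finally show "measure \<rho> {\<tau> \<in> paths. s_tilde (Suc n) \<tau> = Suc k}
      \<le> measure \<rho> {\<tau> \<in> paths. s_tilde n \<tau> = Suc k} + K / real (Suc n) * measure \<rho> {\<tau> \<in> paths. s_tilde n \<tau> = k}"
    by simp
qed

end

text \<open>The constant is the threshold at which the tail bound becomes summable. It is built from \<open>K\<close> alone, so it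
  depends on \<open>z\<close> and \<open>w\<close> only.\<close>

theorem theorem12:
  fixes z w :: complex
  assumes "z \<notin> \<int>" and "w \<notin> \<int>" and "Re (z + w) > - 1 / 2"
  shows "\<exists>c::real. c > 0 \<and>
    (\<forall>\<rho>. is_zw_measure z w \<rho> \<longrightarrow>
      (AE \<tau> in \<rho>. limsup (\<lambda>N. ereal (real (s_tilde N \<tau>) / ln (real N))) \<le> ereal c))"
proof -
  obtain K n0 where K: "K > 0"
    and R: "\<And>n m. n \<ge> n0 \<Longrightarrow> (\<Sum>a<m. reset_ratio z w n (Suc a)) \<le> K / real n"
    using sum_reset_ratio_le[of z w] by metis
  define c where "c = real (nat \<lceil>2 * K\<rceil> + 2) / ln 2"
  have "c > 0" by (simp add: c_def)
  moreover have "AE \<tau> in \<rho>. limsup (\<lambda>N. ereal (real (s_tilde N \<tau>) / ln (real N))) \<le> ereal c"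
    if \<rho>: "is_zw_measure z w \<rho>" for \<rho>
  proof -
    obtain D where D: "\<And>n. n \<ge> Suc (max 1 n0) \<Longrightarrow>
        (\<Sum>k\<le>n. 2 ^ k * measure \<rho> {\<tau> \<in> paths. s_tilde n \<tau> = k}) \<le> D * real n ^ nat \<lceil>2 * K\<rceil>"
      using moment_growth[OF \<rho> assms(1,2) K R] by blast
    have "AE \<tau> in \<rho>. \<forall>\<^sub>F n in sequentially. real (s_tilde n \<tau>) < c * ln (real n)"
      unfolding c_def by (rule AE_s_tilde_less_log[OF \<rho>]) (rule D)
    then show ?thesis
    proof eventually_elim
      case (elim \<tau>)
      then have "\<forall>\<^sub>F n in sequentially. ereal (real (s_tilde n \<tau>) / ln (real n)) \<le> ereal c"
        using eventually_ge_at_top[of 2]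
      proof eventually_elim
        case (elim n)
        then have "ln (real n) > 0" by simp
        then show ?case using elim by (simp add: pos_divide_le_eq)
      qed
      then show ?case by (rule Limsup_bounded)
    qed
  qed
  ultimately show ?thesis by blast
qed

end
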